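(* Let $\mathbb{R}^k_g$ denote the space $\mathbb{R}^k$ endowed with a Riemannian or semi-Riemannian metric $g=(g_{ij})$. The solutions of a system of $n$ point particles with weights (masses) $m_1,m_2,\dots,m_n$ moving under the influence of the pairwise acting potential $U=U(x,y)$, along the positions $X^i(t)$ and velocities $V^i(t)$ in the space $\mathbb{R}^k_g$, satisfy the system of $n$ second order differential equations $$\frac{D V^i}{dt} = -\sum_{j=1}^n m_j\,\nabla^g_x U(X^i,X^j),\qquad i=1,\dots,n,$$ where $\frac{D}{dt}$ is the covariant derivative corresponding to $g$ and $\nabla^g_x$ is the gradient in the metric $g$ with respect to the variable $x$ (the first variable of $U$).
   Context: The setting is the Vlasov-Poisson equation in $\mathbb{R}^k_g$, and the system above is presented as the equations of motion of the particle system associated to it. For a distribution function $F$ of particles moving in the space with velocities $v=(v^1,\dots,v^k)$ at positions $x=(x^1,\dots,x^k)$, this equation is $$\frac{\partial F}{\partial t}+\left\langle v,\frac{\partial F}{\partial x}\right\rangle_g+\left\langle f(F),\frac{\partial F}{\partial v}\right\rangle_g=0,$$ where $\langle\cdot,\cdot\rangle_g$ denotes the scalar product in the metric $g$, and the force is $$f(t,x)=-\nabla^g_x\int U(x,y)\,F(t,v,y)\,dy\,dv,$$ with $U=U(x,y)$ defining an interactive pairwise potential. Here $\nabla^g_z$ denotes the gradient with respect to the variable $z$ in the metric $g$. *)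

theory Defs
  imports "HOL-Analysis.Analysis"
begin

primrec Ck :: "nat \<Rightarrow> ('a::euclidean_space \<Rightarrow> 'b::real_normed_vector) \<Rightarrow> bool" where
  "Ck 0 f \<longleftrightarrow> continuous_on UNIV f"
| "Ck (Suc r) f \<longleftrightarrow>
     (\<forall>x. f differentiable (at x)) \<and> (\<forall>h. Ck r (\<lambda>x. frechet_derivative f (at x) h))"

definition test_function :: "('a::euclidean_space \<Rightarrow> real) \<Rightarrow> bool" where
  "test_function \<phi> \<longleftrightarrow> (\<forall>r. Ck r \<phi>) \<and> compact (closure {z. \<phi> z \<noteq> 0})"


(* The matrix g x has entries g_ij(x). Definiteness is not required, so Riemannian metrics
   are included; the signature is constant because the space is connected. *)
definition semi_riemannian_metric :: "(real^'k \<Rightarrow> real^'k^'k) \<Rightarrow> bool" where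
  "semi_riemannian_metric g \<longleftrightarrow>
     Ck 1 g \<and> (\<forall>x. transpose (g x) = g x \<and> invertible (g x))"

definition metric_inner :: "real^'k^'k \<Rightarrow> real^'k \<Rightarrow> real^'k \<Rightarrow> real" where
  "metric_inner G u w = u \<bullet> (G *v w)"

(* Raising the index of a covector L. *)
definition sharp :: "real^'k^'k \<Rightarrow> (real^'k \<Rightarrow> real) \<Rightarrow> real^'k" where
  "sharp G L = matrix_inv G *v (\<chi> i. L (axis i 1))"

definition metric_gradient ::
  "(real^'k \<Rightarrow> real^'k^'k) \<Rightarrow> (real^'k \<Rightarrow> real) \<Rightarrow> real^'k \<Rightarrow> real^'k" where
  "metric_gradient g h x = sharp (g x) (frechet_derivative h (at x))"

definition partial :: "'k \<Rightarrow> (real^'k \<Rightarrow> real) \<Rightarrow> real^'k \<Rightarrow> real" where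
  "partial i h x = frechet_derivative h (at x) (axis i 1)"

definition christoffel :: "(real^'k \<Rightarrow> real^'k^'k) \<Rightarrow> real^'k \<Rightarrow> 'k \<Rightarrow> 'k \<Rightarrow> 'k \<Rightarrow> real" where
  "christoffel g x l i j = (1/2) * (\<Sum>m\<in>UNIV. matrix_inv (g x) $ l $ m *
     (partial i (\<lambda>y. g y $ j $ m) x + partial j (\<lambda>y. g y $ i $ m) x
      - partial m (\<lambda>y. g y $ i $ j) x))"

definition connection_form ::
  "(real^'k \<Rightarrow> real^'k^'k) \<Rightarrow> real^'k \<Rightarrow> real^'k \<Rightarrow> real^'k \<Rightarrow> real^'k" where
  "connection_form g x u w =
     (\<chi> l. \<Sum>i\<in>UNIV. \<Sum>j\<in>UNIV. christoffel g x l i j * u $ i * w $ j)"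

definition covariant_derivative ::
  "(real^'k \<Rightarrow> real^'k^'k) \<Rightarrow> (real \<Rightarrow> real^'k) \<Rightarrow> (real \<Rightarrow> real^'k) \<Rightarrow> real \<Rightarrow> real^'k" where
  "covariant_derivative g c W t =
     vector_derivative W (at t)
     + connection_form g (c t) (vector_derivative c (at t)) (W t)"


(* Phase space is the tangent bundle, with points (x, v). The derivative in x is covariant:
   v is parallelly transported while x moves, i.e. its components are
   d/dx^i - Gamma^l_ij v^j d/dv^l. For g with constant coefficients this is d/dx^i. *)
definition gradient_x ::
  "(real^'k \<Rightarrow> real^'k^'k) \<Rightarrow> ((real^'k) \<times> (real^'k) \<Rightarrow> real) \<Rightarrow> real^'k \<Rightarrow> real^'k \<Rightarrow> real^'k"
  where
  "gradient_x g \<phi> x v =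
     sharp (g x) (\<lambda>u. frechet_derivative \<phi> (at (x, v)) (u, - connection_form g x u v))"

definition gradient_v ::
  "(real^'k \<Rightarrow> real^'k^'k) \<Rightarrow> ((real^'k) \<times> (real^'k) \<Rightarrow> real) \<Rightarrow> real^'k \<Rightarrow> real^'k \<Rightarrow> real^'k"
  where
  "gradient_v g \<phi> x v = sharp (g x) (frechet_derivative (\<lambda>w. \<phi> (x, w)) (at v))"

(* <v, d phi/dx>_g + <f, d phi/dv>_g *)
definition vlasov_transport ::
  "(real^'k \<Rightarrow> real^'k^'k) \<Rightarrow> (real^'k \<Rightarrow> real^'k) \<Rightarrow> ((real^'k) \<times> (real^'k) \<Rightarrow> real)
     \<Rightarrow> (real^'k) \<times> (real^'k) \<Rightarrow> real" where
  "vlasov_transport g f \<phi> = (\<lambda>(x, v).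
     metric_inner (g x) v (gradient_x g \<phi> x v) + metric_inner (g x) (f x) (gradient_v g \<phi> x v))"

(* The distribution of particles at a fixed time is a finite Borel measure M on phase space,
   which plays the role of F(t,v,y) dy dv. *)
definition vlasov_force ::
  "(real^'k \<Rightarrow> real^'k^'k) \<Rightarrow> (real^'k \<Rightarrow> real^'k \<Rightarrow> real) \<Rightarrow> ((real^'k) \<times> (real^'k)) measure
     \<Rightarrow> real^'k \<Rightarrow> real^'k" where
  "vlasov_force g U M x = - metric_gradient g (\<lambda>x'. LINT (y, v)|M. U x' y) x"

(* Weak form of dF/dt + <v, dF/dx>_g + <f(F), dF/dv>_g = 0. The transport operator is
   skew-symmetric with respect to the Liouville measure |det g| dx dv, which the geodesic flow
   and the velocity-independent force both preserve; moving it to the test function therefore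
   gives no zeroth-order term. *)
definition vlasov_poisson_weak_solution ::
  "(real^'k \<Rightarrow> real^'k^'k) \<Rightarrow> (real^'k \<Rightarrow> real^'k \<Rightarrow> real) \<Rightarrow> real set
     \<Rightarrow> (real \<Rightarrow> ((real^'k) \<times> (real^'k)) measure) \<Rightarrow> bool" where
  "vlasov_poisson_weak_solution g U I F \<longleftrightarrow>
     (\<forall>\<phi>. test_function \<phi> \<longrightarrow> (\<forall>t\<in>I.
        ((\<lambda>s. LINT z|F s. \<phi> z) has_real_derivative
           (LINT z|F t. vlasov_transport g (vlasov_force g U (F t)) \<phi> z)) (at t)))"

(* The sum over i of m_i * delta_(X^i(t)) (x) delta_(V^i(t)), for nonnegative masses. *)
definition particle_distribution ::
  "nat \<Rightarrow> (nat \<Rightarrow> real) \<Rightarrow> (nat \<Rightarrow> real \<Rightarrow> real^'k) \<Rightarrow> (nat \<Rightarrow> real \<Rightarrow> real^'k)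
     \<Rightarrow> real \<Rightarrow> ((real^'k) \<times> (real^'k)) measure" where
  "particle_distribution n m X V t =
     distr (point_measure {1..n} (\<lambda>i. ennreal (m i))) borel (\<lambda>i. (X i t, V i t))"

end

theory Submission
  imports Defs
begin

text \<open>
  Testing the weak equation with \<open>\<phi>\<close> at time \<open>t\<close> gives
  \<open>\<Sum>\<^sub>i m\<^sub>i D\<^sub>v\<phi>(X\<^sub>i, V\<^sub>i) a\<^sub>i = 0\<close>, where \<open>a\<^sub>i\<close> is the defect of the \<open>i\<close>-th equation of motion.
  A bump function around one phase point isolates the particles at that point, so the
  mass-weighted sum of their defects vanishes. If some \<open>a\<^sub>i\<close> were nonzero, it would be nonzero on
  an open set of times; choose there a time at which the number of particles coinciding with
  particle \<open>i\<close> in phase space is minimal. Near that time the coinciding particles stay together,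
  hence have equal defects, and positivity of the masses gives \<open>a\<^sub>i = 0\<close>, a contradiction.
\<close>

section \<open>Calculus of \<open>Ck\<close> functions\<close>

lemma Ck_SucI:
  assumes "\<And>x. (f has_derivative D x) (at x)" "\<And>h. Ck r (\<lambda>x. D x h)"
  shows "Ck (Suc r) f"
proof -
  have "frechet_derivative f (at x) = D x" for x
    using frechet_derivative_at[OF assms(1)] by simp
  then show ?thesis
    using assms by (auto simp: differentiable_def)
qed

lemma Ck_has_derivative:
  assumes "Ck (Suc r) f"
  shows "(f has_derivative frechet_derivative f (at x)) (at x)"
  using assms by (simp add: frechet_derivative_works)

lemma Ck_Suc_imp_Ck: "Ck (Suc r) f \<Longrightarrow> Ck r f"
proof (induction r arbitrary: f)
  case 0
  then show ?case
    by (simp add: continuous_at_imp_continuous_on differentiable_imp_continuous_within)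
qed auto

lemma Ck_const: "Ck r (\<lambda>x. c)"
proof (induction r arbitrary: c)
  case (Suc r)
  show ?case
    by (rule Ck_SucI[OF has_derivative_const Suc])
qed simp

lemma Ck_bounded_linear:
  assumes "bounded_linear f"
  shows "Ck r f"
proof (cases r)
  case 0
  then show ?thesis
    using assms by (simp add: linear_continuous_on)
next
  case (Suc r')
  show ?thesis unfolding Suc
    by (rule Ck_SucI[OF bounded_linear_imp_has_derivative[OF assms] Ck_const])
qed

lemma Ck_add:
  "Ck r f \<Longrightarrow> Ck r g \<Longrightarrow> Ck r (\<lambda>x. f x + g x)"
proof (induction r arbitrary: f g)
  case 0
  then show ?case by (simp add: continuous_on_add)
next
  case (Suc r)
  show ?case
  proof (rule Ck_SucI)
    show "((\<lambda>x. f x + g x) has_derivative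
        (\<lambda>h. frechet_derivative f (at x) h + frechet_derivative g (at x) h)) (at x)" for x
      by (intro has_derivative_add Ck_has_derivative[OF Suc.prems(1)]
          Ck_has_derivative[OF Suc.prems(2)])
    show "Ck r (\<lambda>x. frechet_derivative f (at x) h + frechet_derivative g (at x) h)" for h
      using Suc by simp
  qed
qed

lemma Ck_mult:
  fixes f g :: "'a::euclidean_space \<Rightarrow> real"
  shows "Ck r f \<Longrightarrow> Ck r g \<Longrightarrow> Ck r (\<lambda>x. f x * g x)"
proof (induction r arbitrary: f g)
  case 0
  then show ?case by (simp add: continuous_on_mult)
next
  case (Suc r)
  show ?case
  proof (rule Ck_SucI)
    show "((\<lambda>x. f x * g x) has_derivative
        (\<lambda>h. f x * frechet_derivative g (at x) h + frechet_derivative f (at x) h * g x)) (at x)" for x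
      by (intro has_derivative_mult Ck_has_derivative[OF Suc.prems(1)]
          Ck_has_derivative[OF Suc.prems(2)])
    have "Ck r f" "Ck r g" using Suc.prems Ck_Suc_imp_Ck by blast+
    then show "Ck r (\<lambda>x. f x * frechet_derivative g (at x) h + frechet_derivative f (at x) h * g x)" for h
      using Suc by (intro Ck_add Suc.IH) auto
  qed
qed

text \<open>\<open>Ck 1\<close> controls the derivative only along each fixed direction. Expanding
  the moving direction \<open>w s\<close> in the basis, by linearity, leaves finitely many fixed
  directions with continuous coefficients.\<close>

lemma continuous_on_frechet_derivative:
  fixes f :: "'a::euclidean_space \<Rightarrow> 'b::real_normed_vector"
  assumes "Ck 1 f" and c: "continuous_on S c" and w: "continuous_on S w"
  shows "continuous_on S (\<lambda>s. frechet_derivative f (at (c s)) (w s))"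
proof -
  have C: "Ck (Suc 0) f" using assms(1) by simp
  have "frechet_derivative f (at (c s)) (w s)
      = (\<Sum>b\<in>Basis. (w s \<bullet> b) *\<^sub>R frechet_derivative f (at (c s)) b)" for s
  proof -
    interpret linear "frechet_derivative f (at (c s))"
      using Ck_has_derivative[OF C] has_derivative_linear by blast
    have "frechet_derivative f (at (c s)) (w s)
        = frechet_derivative f (at (c s)) (\<Sum>b\<in>Basis. (w s \<bullet> b) *\<^sub>R b)"
      by (simp add: euclidean_representation)
    then show ?thesis by (simp add: sum scale)
  qed
  moreover have "continuous_on S (\<lambda>s. frechet_derivative f (at (c s)) b)" for b
    using C by (intro continuous_on_compose2[OF _ c]) auto
  ultimately show ?thesis
    using w by (simp add: continuous_intros)
qed

section \<open>Smooth bump functions and test functions with prescribed differentials\<close>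

definition flat_exp :: "nat \<Rightarrow> real \<Rightarrow> real" where
  "flat_exp k s = (if s > 0 then exp (- inverse s) * inverse s ^ k else 0)"

text \<open>The family \<open>flat_exp k\<close> is used in place of \<open>flat_exp 0\<close> alone because its derivatives stay
  in its linear span.\<close>

lemma flat_exp_tendsto_0: "(flat_exp k \<longlongrightarrow> 0) (at 0)"
proof -
  have "((\<lambda>s::real. inverse s ^ k / exp (inverse s)) \<longlongrightarrow> 0) (at_right 0)"
    by (rule filterlim_compose[OF tendsto_power_div_exp_0 filterlim_inverse_at_top_right])
  moreover have "\<forall>\<^sub>F s in at_right 0. inverse s ^ k / exp (inverse s) = flat_exp k s"
    using eventually_at_right_less[of 0]
    by eventually_elim (simp add: flat_exp_def exp_minus divide_inverse)
  ultimately have "(flat_exp k \<longlongrightarrow> 0) (at_right 0)"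
    using Lim_transform_eventually by blast
  moreover have "(flat_exp k \<longlongrightarrow> 0) (at_left 0)"
    by (rule tendsto_eventually) (auto simp: flat_exp_def eventually_at_filter)
  ultimately show ?thesis
    by (simp add: filterlim_at_split)
qed

lemma flat_exp_has_derivative:
  "(flat_exp k has_real_derivative flat_exp (k + 2) s - k * flat_exp (k + 1) s) (at s)"
proof -
  consider "s > 0" | "s = 0" | "s < 0" by linarith
  then show ?thesis
  proof cases
    case 1
    \<comment> \<open>The truncated exponent \<open>k - 1\<close> is harmless at
      \<open>k = 0\<close>, where the factor \<open>k\<close> kills both sides.\<close>
    have "real k * inverse s ^ (k - 1) * inverse s = k * inverse s ^ k"
      by (cases k) auto
    then have "((\<lambda>s. exp (- inverse s) * inverse s ^ k) has_real_derivative
        flat_exp (k + 2) s - k * flat_exp (k + 1) s) (at s)"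
      using 1 by (auto intro!: derivative_eq_intros simp: flat_exp_def algebra_simps)
    then show ?thesis
      by (rule has_field_derivative_transform_within_open[where S="{0<..}"])
        (use 1 in \<open>auto simp: flat_exp_def\<close>)
  next
    case 2
    \<comment> \<open>Dividing by \<open>h\<close> raises the index by one, so the difference
      quotient at 0 is again a member of the family and tends to 0.\<close>
    have "\<forall>\<^sub>F h in at 0. flat_exp (k + 1) h = (flat_exp k (0 + h) - flat_exp k 0) / h"
      by (auto simp: eventually_at_filter flat_exp_def field_simps)
    from Lim_transform_eventually[OF flat_exp_tendsto_0 this]
    have "(flat_exp k has_real_derivative 0) (at 0)"
      by (simp add: DERIV_def)
    then show ?thesis using 2 by (simp add: flat_exp_def)
  next
    case 3
    have "(flat_exp k has_real_derivative 0) (at s)"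
      by (rule has_field_derivative_transform_within_open[where S="{..<0}" and f="\<lambda>_. 0"])
        (use 3 in \<open>auto simp: flat_exp_def\<close>)
    then show ?thesis using 3 by (simp add: flat_exp_def)
  qed
qed

text \<open>The squared distance, unlike the distance, is smooth at the centre \<open>a\<close>. For
  \<open>r > 0\<close> the function is positive exactly on the open ball of radius
  \<open>r\<close>.\<close>

definition bump :: "'a::euclidean_space \<Rightarrow> real \<Rightarrow> nat \<Rightarrow> 'a \<Rightarrow> real" where
  "bump a r k z = flat_exp k (r\<^sup>2 - (z - a) \<bullet> (z - a))"

lemma bump_has_derivative:
  "(bump a r k has_derivative
     (\<lambda>h. (bump a r (k + 2) z - k * bump a r (k + 1) z) * (- 2 * (h \<bullet> (z - a))))) (at z)"
proof -
  have "((\<lambda>z. r\<^sup>2 - (z - a) \<bullet> (z - a)) has_derivative (\<lambda>h. - 2 * (h \<bullet> (z - a)))) (at z)"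
    by (auto intro!: derivative_eq_intros simp: inner_commute)
  from has_derivative_compose[OF this flat_exp_has_derivative[THEN has_field_derivative_imp_has_derivative]]
  show ?thesis
    unfolding bump_def by simp
qed

text \<open>The derivative is an affine function times a combination of bumps of index
  \<open>k + 1\<close> and \<open>k + 2\<close>, so the induction on the order keeps
  \<open>k\<close> arbitrary.\<close>

lemma Ck_bump: "Ck r (bump a \<rho> k)"
proof (induction r arbitrary: k)
  case 0
  show ?case
    using bump_has_derivative has_derivative_continuous
    by (fastforce intro: continuous_at_imp_continuous_on)
next
  case (Suc r)
  show ?case
  proof (rule Ck_SucI[OF bump_has_derivative])
    fix h :: 'a
    have aff: "Ck r (\<lambda>z. - 2 * (h \<bullet> (z - a)))"
    proof -
      have "Ck r (\<lambda>z. (- 2) * (h \<bullet> z) + 2 * (h \<bullet> a))"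
        by (intro Ck_add Ck_const Ck_mult Ck_bounded_linear bounded_linear_inner_right)
      then show ?thesis by (simp add: inner_diff_right algebra_simps)
    qed
    have "Ck r (\<lambda>z. (bump a \<rho> (k + 2) z + (- real k) * bump a \<rho> (k + 1) z) * (- 2 * (h \<bullet> (z - a))))"
      by (intro Ck_mult Ck_add Ck_const Suc aff)
    then show "Ck r (\<lambda>z. (bump a \<rho> (k + 2) z - k * bump a \<rho> (k + 1) z) * (- 2 * (h \<bullet> (z - a))))"
      by simp
  qed
qed

text \<open>Take a linear functional of \<open>z - a\<close> times a bump at \<open>a\<close> whose
  support avoids \<open>S\<close>. At \<open>a\<close> the linear factor vanishes, so the product
  rule leaves only its differential, scaled by the positive height of the bump.\<close>

lemma exists_test_function_separating:
  fixes a c :: "'a::euclidean_space"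
  assumes "finite S" "a \<notin> S"
  obtains \<phi> \<kappa> where "test_function \<phi>" "\<kappa> > 0"
    "\<And>h. frechet_derivative \<phi> (at a) h = \<kappa> * (h \<bullet> c)"
    "\<And>s h. s \<in> S \<Longrightarrow> frechet_derivative \<phi> (at s) h = 0"
proof -
  obtain r where r: "r > 0" "\<And>s. s \<in> S \<Longrightarrow> r < dist s a"
  proof -
    obtain d where "d > 0" and d: "\<forall>x\<in>S. x \<noteq> a \<longrightarrow> d \<le> dist a x"
      using finite_set_avoid[OF assms(1)] by blast
    \<comment> \<open>Halving the gap makes the inequality strict: \<open>S\<close> then lies in the
      open complement of the closed ball, where \<phi> vanishes identically and so does its
      derivative.\<close>
    then show thesis
      using that[of "d/2"] assms(2) by (force simp: dist_commute)
  qed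
  define \<phi> where "\<phi> z = ((z - a) \<bullet> c) * bump a r 0 z" for z
  have far: "\<phi> z = 0" if "r \<le> dist z a" for z
  proof -
    have "r\<^sup>2 \<le> (dist z a)\<^sup>2" using that r(1) by (intro power_mono) auto
    then show ?thesis
      by (simp add: \<phi>_def bump_def flat_exp_def dist_norm power2_norm_eq_inner)
  qed
  have der: "(\<phi> has_derivative (\<lambda>h. ((z - a) \<bullet> c) * frechet_derivative (bump a r 0) (at z) h
      + (h \<bullet> c) * bump a r 0 z)) (at z)" for z
    unfolding \<phi>_def
    by (intro has_derivative_mult Ck_has_derivative[OF Ck_bump])
      (auto intro!: derivative_eq_intros)
  show thesis
  proof
    have "Ck q (\<lambda>z. (z \<bullet> c + - (a \<bullet> c)) * bump a r 0 z)" for q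
      by (intro Ck_mult Ck_bump Ck_add Ck_const Ck_bounded_linear bounded_linear_inner_left)
    then have "Ck q \<phi>" for q
      unfolding \<phi>_def by (simp add: inner_diff_left)
    moreover have "{z. \<phi> z \<noteq> 0} \<subseteq> cball a r"
      using far by (force simp: dist_commute)
    ultimately show "test_function \<phi>"
      by (auto simp: test_function_def intro: bounded_subset)
    show "bump a r 0 a > 0"
      using r(1) by (simp add: bump_def flat_exp_def)
    show "frechet_derivative \<phi> (at a) h = bump a r 0 a * (h \<bullet> c)" for h
      using frechet_derivative_at[OF der[of a]] by (simp add: fun_eq_iff mult.commute)
    show "frechet_derivative \<phi> (at s) h = 0" if "s \<in> S" for s h
    proof -
      have "(\<phi> has_derivative (\<lambda>h. 0)) (at s)"
      proof (rule has_derivative_transform_within_open[where s="- cball a r" and f="\<lambda>_. 0"])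
        show "s \<in> - cball a r" using r(2)[OF that] by (simp add: dist_commute)
        show "0 = \<phi> x" if "x \<in> - cball a r" for x
          using far that by (simp add: dist_commute)
      qed auto
      then show ?thesis
        using frechet_derivative_at by (metis)
    qed
  qed
qed

section \<open>Continuity of the inverse matrix and raising of indices\<close>

lemma matrix_inv_right:
  fixes A :: "'a::field^'n^'n"
  assumes "invertible A"
  shows "A ** matrix_inv A = mat 1"
  using assms unfolding invertible_def matrix_inv_def by (rule someI2_ex) blast

lemma continuous_on_det:
  fixes A :: "'a::topological_space \<Rightarrow> real^'n^'n"
  assumes "\<And>i j. continuous_on S (\<lambda>s. A s $ i $ j)"
  shows "continuous_on S (\<lambda>s. det (A s))"
  unfolding det_def by (intro continuous_on_sum continuous_on_mult_left continuous_on_prod assms)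

text \<open>Cramer's rule writes each entry of the inverse as a quotient of determinants, which are
  polynomials in continuous entries; invertibility keeps the denominator nonzero.\<close>

lemma continuous_on_matrix_inv:
  fixes A :: "'a::topological_space \<Rightarrow> real^'n^'n"
  assumes A: "continuous_on S A" and inv: "\<And>s. s \<in> S \<Longrightarrow> invertible (A s)"
  shows "continuous_on S (\<lambda>s. matrix_inv (A s))"
proof -
  have entry: "matrix_inv (A s) $ i $ j
      = det (\<chi> p q. if q = i then axis j 1 $ p else A s $ p $ q) / det (A s)"
    if "s \<in> S" for s i j
  proof -
    have "A s *v (matrix_inv (A s) *v axis j 1) = axis j 1"
      by (simp add: matrix_vector_mul_assoc inv[OF that] matrix_inv_right)
    then have "matrix_inv (A s) *v axis j 1
        = (\<chi> k. det (\<chi> p q. if q = k then axis j 1 $ p else A s $ p $ q) / det (A s))"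
      using cramer inv[OF that] invertible_det_nz by blast
    then show ?thesis
      by (simp add: matrix_vector_mult_basis column_def vec_eq_iff)
  qed
  have "continuous_on S (\<lambda>s. if q = i then axis j 1 $ p else A s $ p $ q)" for i j p q
    using A by (cases "q = i") (auto intro!: continuous_intros)
  then have "continuous_on S (\<lambda>s. matrix_inv (A s) $ i $ j)" for i j
    using A inv
    by (auto simp: entry invertible_det_nz cong: continuous_on_cong
        intro!: continuous_intros continuous_on_det)
  then show ?thesis
    by (subst vec_lambda_eta[symmetric], intro continuous_on_vec_lambda)
       (subst vec_lambda_eta[symmetric], intro continuous_on_vec_lambda)
qed

lemma sharp_continuous_on:
  assumes "continuous_on S G" "\<And>s. s \<in> S \<Longrightarrow> invertible (G s)"
    and "\<And>i. continuous_on S (\<lambda>s. L s (axis i 1))"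
  shows "continuous_on S (\<lambda>s. sharp (G s) (L s))"
proof -
  have "continuous_on S (\<lambda>s. matrix_inv (G s) $ i $ j)" for i j
    using continuous_on_matrix_inv[OF assms(1,2)] by (intro continuous_intros)
  then show ?thesis
    unfolding sharp_def matrix_vector_mult_def vec_lambda_beta
    by (intro continuous_on_vec_lambda continuous_on_sum continuous_on_mult assms(3))
qed

text \<open>Lowering the index cancels raising it. Scalar products with gradients thereby become
  plain differentials, and the metric survives in the transport operator only through the connection
  and the force.\<close>

lemma metric_inner_sharp:
  assumes "transpose G = G" "invertible G" "linear L"
  shows "metric_inner G u (sharp G L) = L u"
proof -
  interpret linear L by fact
  have "metric_inner G u (sharp G L) = u \<bullet> (\<chi> i. L (axis i 1))"
    by (simp add: metric_inner_def sharp_def matrix_vector_mul_assoc assms(2) matrix_inv_right)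
  also have "\<dots> = (\<Sum>i\<in>UNIV. u $ i * L (axis i 1))"
    by (simp add: inner_vec_def)
  also have "\<dots> = L (\<Sum>i\<in>UNIV. u $ i *s axis i 1)"
    by (simp add: sum scale scalar_mult_eq_scaleR)
  finally show ?thesis by (simp add: basis_expansion)
qed

section \<open>The connection and the transport operator of a fixed metric\<close>

context
  fixes g :: "real^'k \<Rightarrow> real^'k^'k"
  assumes metric: "semi_riemannian_metric g"
begin

lemma metric_C1: "Ck (Suc 0) g"
  using metric by (simp add: semi_riemannian_metric_def)

lemma metric_transpose: "transpose (g x) = g x"
  and metric_invertible: "invertible (g x)"
  using metric by (auto simp: semi_riemannian_metric_def)

lemma metric_continuous_on:
  assumes "continuous_on S c"
  shows "continuous_on S (\<lambda>s. g (c s))"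
  using Ck_Suc_imp_Ck[OF metric_C1] assms
  by (auto intro: continuous_on_compose2)

lemma christoffel_continuous_on:
  assumes c: "continuous_on S c"
  shows "continuous_on S (\<lambda>s. christoffel g (c s) l i j)"
proof -
  \<comment> \<open>Partial derivatives of the entries are entries of the derivative of the
    matrix-valued \<open>g\<close>, whose continuity comes from the regularity of the
    metric.\<close>
  have "partial p (\<lambda>y. g y $ q $ r) x = frechet_derivative g (at x) (axis p 1) $ q $ r" for p q r x
  proof -
    have "((\<lambda>y. g y $ q $ r) has_derivative (\<lambda>h. frechet_derivative g (at x) h $ q $ r)) (at x)"
      by (intro bounded_linear.has_derivative[OF bounded_linear_vec_nth] Ck_has_derivative[OF metric_C1])
    from frechet_derivative_at[OF this] show ?thesis
      by (simp add: partial_def fun_eq_iff)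
  qed
  moreover have "continuous_on S (\<lambda>s. frechet_derivative g (at (c s)) (axis p 1))" for p
    using metric_C1 by (intro continuous_on_frechet_derivative c) auto
  moreover have "continuous_on S (\<lambda>s. matrix_inv (g (c s)))"
    by (intro continuous_on_matrix_inv metric_continuous_on c metric_invertible)
  ultimately show ?thesis
    unfolding christoffel_def by (simp add: continuous_intros)
qed

lemma connection_form_continuous_on:
  assumes "continuous_on S c" "continuous_on S u" "continuous_on S w"
  shows "continuous_on S (\<lambda>s. connection_form g (c s) (u s) (w s))"
  unfolding connection_form_def
  using assms by (intro continuous_intros christoffel_continuous_on)

lemma connection_form_linear: "linear (\<lambda>u. connection_form g x u w)"
  by (rule linearI)
    (simp_all add: connection_form_def vec_eq_iff algebra_simps sum.distrib sum_distrib_left)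

text \<open>The x-part contributes the geodesic spray (v, -Gamma(v, v)) and the v-part the vertical
  vector (0, f). Transport is thus differentiation along the phase-space field of the forced
  geodesic equation.\<close>

lemma vlasov_transport_eq:
  assumes "Ck 1 \<phi>"
  shows "vlasov_transport g f \<phi> (x, v)
    = frechet_derivative \<phi> (at (x, v)) (v, f x - connection_form g x v v)"
proof -
  have C: "Ck (Suc 0) \<phi>" using assms by simp
  define D where "D = frechet_derivative \<phi> (at (x, v))"
  have D: "(\<phi> has_derivative D) (at (x, v))"
    unfolding D_def by (rule Ck_has_derivative[OF C])
  then interpret D: linear D
    by (rule has_derivative_linear)
  have "linear (\<lambda>u. (u, - connection_form g x u v))"
    by (rule linearI)
      (simp_all add: linear_add[OF connection_form_linear] linear_scale[OF connection_form_linear])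
  from linear_compose[OF this D.linear_axioms]
  have "linear (\<lambda>u. D (u, - connection_form g x u v))"
    by (simp add: o_def)
  then have x: "metric_inner (g x) v (gradient_x g \<phi> x v) = D (v, - connection_form g x v v)"
    by (simp add: gradient_x_def D_def metric_inner_sharp metric_transpose metric_invertible)
  have "((\<lambda>w. \<phi> (x, w)) has_derivative (\<lambda>h. D (0, h))) (at v)"
    by (rule has_derivative_compose[of "\<lambda>w. (x, w)" "\<lambda>h. (0, h)" _ _ \<phi> D, OF _ D])
      (auto intro!: derivative_eq_intros)
  then have "frechet_derivative (\<lambda>w. \<phi> (x, w)) (at v) = (\<lambda>h. D (0, h))"
    by (rule frechet_derivative_at[symmetric])
  moreover have "linear (\<lambda>h. D (0, h))"
    using \<open>((\<lambda>w. \<phi> (x, w)) has_derivative (\<lambda>h. D (0, h))) (at v)\<close>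
    by (rule has_derivative_linear)
  ultimately have "metric_inner (g x) (f x) (gradient_v g \<phi> x v) = D (0, f x)"
    by (simp add: gradient_v_def metric_inner_sharp metric_transpose metric_invertible)
  with x show ?thesis
    unfolding vlasov_transport_def D_def[symmetric] by (simp flip: D.add)
qed

end

section \<open>Integrals and forces of particle distributions\<close>

lemma integral_particle_distribution:
  assumes "\<And>i. i \<in> {1..n} \<Longrightarrow> m i > 0" "h \<in> borel_measurable borel"
  shows "(LINT z|particle_distribution n m X V t. h z) = (\<Sum>i=1..n. m i * h (X i t, V i t))"
proof -
  have "(LINT z|particle_distribution n m X V t. h z)
      = (LINT i|point_measure {1..n} (\<lambda>i. ennreal (m i)). h (X i t, V i t))"
    unfolding particle_distribution_def using assms(2) by (subst integral_distr) auto
  \<comment> \<open>\<open>ennreal\<close> sends negative reals to 0, so the weights come back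
    unchanged only because the masses are nonnegative.\<close>
  also have "\<dots> = (\<Sum>i=1..n. m i *\<^sub>R h (X i t, V i t))"
    by (rule lebesgue_integral_point_measure_finite) (rule finite_atLeastAtMost, rule less_imp_le, rule assms(1))
  finally show ?thesis by simp
qed

context
  fixes U :: "real^'k \<Rightarrow> real^'k \<Rightarrow> real"
  assumes U: "Ck 1 (\<lambda>(x, y). U x y)"
begin

lemma potential_has_derivative:
  "((\<lambda>x. U x y) has_derivative
     (\<lambda>h. frechet_derivative (\<lambda>(x, y). U x y) (at (x, y)) (h, 0))) (at x)"
proof -
  have "((\<lambda>x. (x, y)) has_derivative (\<lambda>h. (h, 0))) (at x)"
    by (auto intro!: derivative_eq_intros)
  from has_derivative_compose[OF this Ck_has_derivative[OF U[unfolded One_nat_def]]]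
  show ?thesis by simp
qed

lemma potential_gradient_continuous_on:
  assumes "semi_riemannian_metric g" "continuous_on S c" "continuous_on S d"
  shows "continuous_on S (\<lambda>s. metric_gradient g (\<lambda>x. U x (d s)) (c s))"
  unfolding metric_gradient_def frechet_derivative_at[OF potential_has_derivative, symmetric]
  using assms
  by (intro sharp_continuous_on metric_continuous_on metric_invertible
      continuous_on_frechet_derivative[OF U] continuous_intros)

text \<open>Integration collapses to a finite sum and the gradient is linear. It acts on
  \<open>x\<close> with every \<open>X j t\<close> frozen, so at the position of a particle its own
  term is still a gradient in the first variable only.\<close>

lemma vlasov_force_particle_distribution:
  assumes "\<And>i. i \<in> {1..n} \<Longrightarrow> m i > 0"
  shows "vlasov_force g U (particle_distribution n m X V t) x
    = - (\<Sum>j=1..n. m j *\<^sub>R metric_gradient g (\<lambda>x. U x (X j t)) x)"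
proof -
  have C: "continuous_on UNIV (\<lambda>(x, y). U x y)"
    using U Ck_Suc_imp_Ck[of 0 "\<lambda>(x, y). U x y"] by simp
  have "(\<lambda>(y, v :: real^'k). U x' y) \<in> borel_measurable borel" for x'
    using continuous_on_compose2[OF C, of UNIV "\<lambda>z. (x', fst z)"]
    by (intro borel_measurable_continuous_onI)
      (simp add: case_prod_beta' continuous_on_Pair continuous_on_fst)
  then have "(LINT (y, v)|particle_distribution n m X V t. U x' y) = (\<Sum>j=1..n. m j * U x' (X j t))"
    for x'
    using integral_particle_distribution[of n m "\<lambda>(y, v). U x' y"] assms by simp
  moreover
  have "((\<lambda>x. \<Sum>j=1..n. m j * U x (X j t)) has_derivative (\<lambda>h. \<Sum>j=1..n. m j *
      frechet_derivative (\<lambda>x. U x (X j t)) (at x) h)) (at x)"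
    by (intro has_derivative_sum has_derivative_mult_right)
      (metis potential_has_derivative frechet_derivative_at)
  ultimately show ?thesis
    unfolding vlasov_force_def metric_gradient_def sharp_def
    by (simp add: frechet_derivative_at[symmetric] matrix_vector_mult_def vec_eq_iff
        sum_distrib_left sum.swap[of _ UNIV] algebra_simps)
qed

end

section \<open>From the weak equation to the equations of motion\<close>

theorem theorem1:
  fixes g :: "real^'k \<Rightarrow> real^'k^'k"
    and U :: "real^'k \<Rightarrow> real^'k \<Rightarrow> real"
    and n :: nat and m :: "nat \<Rightarrow> real" and I :: "real set"
    and X V :: "nat \<Rightarrow> real \<Rightarrow> real^'k"
  assumes metric: "semi_riemannian_metric g"
    and potential: "Ck 1 (\<lambda>(x, y). U x y)"
    and masses: "\<And>i. i \<in> {1..n} \<Longrightarrow> m i > 0"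
    and time: "open I"
    and velocity: "\<And>i t. i \<in> {1..n} \<Longrightarrow> t \<in> I \<Longrightarrow> (X i has_vector_derivative V i t) (at t)"
    and regular: "\<And>i. i \<in> {1..n} \<Longrightarrow> V i C1_differentiable_on I"
    and motion: "vlasov_poisson_weak_solution g U I (particle_distribution n m X V)"
  shows "\<forall>i\<in>{1..n}. \<forall>t\<in>I.
    covariant_derivative g (X i) (V i) t
      = - (\<Sum>j=1..n. m j *\<^sub>R metric_gradient g (\<lambda>x. U x (X j t)) (X i t))"
proof (intro ballI)
  define Z where "Z i t = (X i t, V i t)" for i t
  define f where "f t = vlasov_force g U (particle_distribution n m X V t)" for t
  define A where "A i t = vector_derivative (V i) (at t)" for i t
  \<comment> \<open>Since \<open>V i\<close> is the derivative of \<open>X i\<close> on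
    \<open>I\<close>, this is the covariant derivative of \<open>V i\<close> minus the force at
    \<open>X i t\<close>.\<close>
  define a where "a i t = A i t + connection_form g (X i t) (V i t) (V i t) - f t (X i t)" for i t

  have f: "f t x = - (\<Sum>j=1..n. m j *\<^sub>R metric_gradient g (\<lambda>x. U x (X j t)) x)" for t x
    unfolding f_def by (rule vlasov_force_particle_distribution[OF potential masses])
  have V: "(V i has_vector_derivative A i t) (at t)" if "i \<in> {1..n}" "t \<in> I" for i t
    using regular[OF that(1)] that(2) vector_derivative_at
    unfolding C1_differentiable_on_def A_def by metis
  have A_cont: "continuous_on I (A i)" if "i \<in> {1..n}" for i
    using regular[OF that] vector_derivative_at
    unfolding C1_differentiable_on_def A_def by (metis (no_types, lifting) continuous_on_cong)
  have X_cont: "continuous_on I (X i)" and V_cont: "continuous_on I (V i)" if "i \<in> {1..n}" for i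
    using velocity[OF that] V[OF that] has_vector_derivative_continuous
    by (blast intro: continuous_at_imp_continuous_on)+
  have Z_cont: "continuous_on I (Z i)" if "i \<in> {1..n}" for i
    unfolding Z_def by (intro continuous_intros X_cont V_cont that)
  have Z: "(Z i has_vector_derivative (V i t, A i t)) (at t)" if "i \<in> {1..n}" "t \<in> I" for i t
    unfolding Z_def by (intro has_vector_derivative_Pair velocity V that)
  \<comment> \<open>Continuity makes the set of times with nonzero defect open.\<close>
  have a_cont: "continuous_on I (a i)" if "i \<in> {1..n}" for i
    unfolding a_def f
    by (intro continuous_intros A_cont connection_form_continuous_on[OF metric]
        potential_gradient_continuous_on[OF potential metric] X_cont V_cont that)

  \<comment> \<open>The chain rule along the trajectories and the transport term both give
    derivatives of \<phi> in directions with the same x-component \<open>V i t\<close>; subtracting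
    them leaves the vertical direction \<open>(0, a i t)\<close>.\<close>
  have weak: "(\<Sum>i=1..n. m i * frechet_derivative \<phi> (at (Z i t)) (0, a i t)) = 0"
    if \<phi>: "test_function \<phi>" and t: "t \<in> I" for \<phi> t
  proof -
    have C1: "Ck (Suc 0) \<phi>" using \<phi> by (simp only: test_function_def)
    have "((\<lambda>s. m i * \<phi> (Z i s)) has_real_derivative
        m i * frechet_derivative \<phi> (at (Z i t)) (V i t, A i t)) (at t)" if "i \<in> {1..n}" for i
    proof (rule DERIV_cmult)
      interpret linear "frechet_derivative \<phi> (at (Z i t))"
        using Ck_has_derivative[OF C1] by (rule has_derivative_linear)
      show "((\<lambda>s. \<phi> (Z i s)) has_real_derivative
          frechet_derivative \<phi> (at (Z i t)) (V i t, A i t)) (at t)"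
        using has_derivative_compose[OF Z[OF that t, unfolded has_vector_derivative_def]
            Ck_has_derivative[OF C1]]
        unfolding has_field_derivative_def
        by (rule has_derivative_eq_rhs) (simp only: fun_eq_iff scale real_scaleR_def mult.commute simp_thms)
    qed
    then have "((\<lambda>s. \<Sum>i=1..n. m i * \<phi> (Z i s)) has_real_derivative
        (\<Sum>i=1..n. m i * frechet_derivative \<phi> (at (Z i t)) (V i t, A i t))) (at t)"
      by (rule DERIV_sum)
    moreover have "(LINT z|particle_distribution n m X V s. \<phi> z) = (\<Sum>i=1..n. m i * \<phi> (Z i s))" for s
      unfolding Z_def
      using Ck_Suc_imp_Ck[OF C1]
      by (intro integral_particle_distribution masses borel_measurable_continuous_onI) auto
    moreover have "(LINT z|particle_distribution n m X V t. vlasov_transport g (f t) \<phi> z)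
      = (\<Sum>i=1..n. m i * frechet_derivative \<phi> (at (Z i t))
          (V i t, f t (X i t) - connection_form g (X i t) (V i t) (V i t)))"
    proof -
      have T: "vlasov_transport g (f t) \<phi> = (\<lambda>z. frechet_derivative \<phi> (at z)
          (snd z, f t (fst z) - connection_form g (fst z) (snd z) (snd z)))"
        using vlasov_transport_eq[OF metric, of \<phi> "f t"] C1 by (auto simp: fun_eq_iff)
      \<comment> \<open>Continuity supplies the measurability needed to integrate against the
        particle distribution.\<close>
      have "continuous_on UNIV (vlasov_transport g (f t) \<phi>)"
        unfolding T f using C1
        by (intro continuous_on_frechet_derivative continuous_intros
            connection_form_continuous_on[OF metric]
            potential_gradient_continuous_on[OF potential metric]) auto
      from integral_particle_distribution[OF masses borel_measurable_continuous_onI[OF this],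
          where n=n and X=X and V=V and t=t]
      show ?thesis by (simp add: T Z_def)
    qed
    ultimately have "(\<Sum>i=1..n. m i * frechet_derivative \<phi> (at (Z i t)) (V i t, A i t))
      = (\<Sum>i=1..n. m i * frechet_derivative \<phi> (at (Z i t))
          (V i t, f t (X i t) - connection_form g (X i t) (V i t) (V i t)))"
      using motion \<phi> t unfolding vlasov_poisson_weak_solution_def f_def
      by (metis (no_types, lifting) DERIV_unique ext)
    moreover have "frechet_derivative \<phi> (at (Z i t)) (0, a i t)
      = frechet_derivative \<phi> (at (Z i t)) (V i t, A i t) - frechet_derivative \<phi> (at (Z i t))
          (V i t, f t (X i t) - connection_form g (X i t) (V i t) (V i t))" for i
      by (simp add: a_def diff_diff_eq2
          flip: linear_diff[OF has_derivative_linear[OF Ck_has_derivative[OF C1]]])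
    ultimately show ?thesis
      by (simp add: right_diff_distrib sum_subtractf)
  qed

  fix i t\<^sub>0 assume i: "i \<in> {1..n}" and t\<^sub>0: "t\<^sub>0 \<in> I"
  have "a i t\<^sub>0 = 0"
  proof (rule ccontr)
    assume nz: "a i t\<^sub>0 \<noteq> 0"
    define J where "J = I \<inter> a i -` (- {0})"
    define C where "C t = {j\<in>{1..n}. Z j t = Z i t}" for t
    have J: "open J" "t\<^sub>0 \<in> J" "J \<subseteq> I"
      using nz t\<^sub>0 continuous_open_preimage[OF a_cont[OF i] time] by (auto simp: J_def)
    obtain t where t: "t \<in> J" and least: "\<And>s. s \<in> J \<Longrightarrow> card (C t) \<le> card (C s)"
      using ex_has_least_nat[of "\<lambda>t. t \<in> J" t\<^sub>0 "\<lambda>t. card (C t)"] J(2) by blast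
    \<comment> \<open>Particles apart from particle \<open>i\<close> at time \<open>t\<close> remain
      apart from it on \<open>W\<close>. Hence \<open>C s\<close> can only shrink there, and
      minimality of the cardinality at \<open>t\<close> forbids shrinking.\<close>
    define W where "W = J \<inter> (\<Inter>j\<in>{1..n} - C t. I \<inter> (\<lambda>s. Z j s - Z i s) -` (- {0}))"
    have "open W"
      unfolding W_def
      by (intro open_Int open_INT ballI J continuous_open_preimage time continuous_intros Z_cont i) auto
    have "t \<in> W" using t J by (auto simp: W_def C_def)
    have C_const: "C s = C t" if "s \<in> W" for s
    proof (rule card_seteq)
      have "j \<notin> C s" if j: "j \<in> {1..n} - C t" for j
      proof -
        have "s \<in> I \<inter> (\<lambda>s. Z j s - Z i s) -` (- {0})"
          using j \<open>s \<in> W\<close> unfolding W_def by blast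
        then show ?thesis by (simp add: C_def)
      qed
      then show "C s \<subseteq> C t" unfolding C_def by blast
      show "card (C t) \<le> card (C s)" using that least by (simp add: W_def)
    qed (simp add: C_def)
    \<comment> \<open>Coincidence at the single time \<open>t\<close> would not equate
      accelerations; coincidence throughout the open set \<open>W\<close> does.\<close>
    have a_eq: "a j t = a i t" if j: "j \<in> C t" for j
    proof -
      have Z_eq: "Z j s = Z i s" if "s \<in> W" for s
        using C_const[OF that] j by (auto simp: C_def)
      then have "(V j has_vector_derivative A i t) (at t)"
        using has_vector_derivative_transform_within_open[OF V[OF i] \<open>open W\<close> \<open>t \<in> W\<close>] t J(3)
        by (auto simp: Z_def)
      then have "A j t = A i t" by (simp add: A_def vector_derivative_at)
      then show ?thesis using Z_eq[OF \<open>t \<in> W\<close>] by (simp add: a_def Z_def)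
    qed
    \<comment> \<open>Prescribing the differential along \<open>(0, a i t)\<close> in the Euclidean
      inner product makes every surviving term a positive multiple of the squared Euclidean norm of
      the defect, even when \<open>g\<close> is indefinite.\<close>
    obtain \<phi> \<kappa> where \<phi>: "test_function \<phi>" "\<kappa> > 0"
      "\<And>h. frechet_derivative \<phi> (at (Z i t)) h = \<kappa> * (h \<bullet> (0, a i t))"
      "\<And>s h. s \<in> (\<lambda>j. Z j t) ` ({1..n} - C t) \<Longrightarrow> frechet_derivative \<phi> (at s) h = 0"
      by (rule exists_test_function_separating[of "(\<lambda>j. Z j t) ` ({1..n} - C t)" "Z i t" "(0, a i t)"])
        (auto simp: C_def)
    have "0 = (\<Sum>j=1..n. m j * frechet_derivative \<phi> (at (Z j t)) (0, a j t))"
      using weak[OF \<phi>(1)] t J(3) by auto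
    also have "\<dots> = (\<Sum>j\<in>C t. m j * frechet_derivative \<phi> (at (Z j t)) (0, a j t))"
      using \<phi>(4) by (intro sum.mono_neutral_right) (auto simp: C_def)
    also have "\<dots> = (\<Sum>j\<in>C t. m j * (\<kappa> * (a i t \<bullet> a i t)))"
    proof (rule sum.cong)
      fix j assume j: "j \<in> C t"
      then have "Z j t = Z i t" by (simp add: C_def)
      then show "m j * frechet_derivative \<phi> (at (Z j t)) (0, a j t) = m j * (\<kappa> * (a i t \<bullet> a i t))"
        using a_eq[OF j] \<phi>(3) by simp
    qed simp
    \<comment> \<open>The sum is nonempty because \<open>i\<close> itself belongs to
      \<open>C t\<close>.\<close>
    also have "\<dots> > 0"
      using i t masses \<phi>(2) by (intro sum_pos) (auto simp: C_def J_def)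
    finally show False by simp
  qed
  then show "covariant_derivative g (X i) (V i) t\<^sub>0
      = - (\<Sum>j=1..n. m j *\<^sub>R metric_gradient g (\<lambda>x. U x (X j t\<^sub>0)) (X i t\<^sub>0))"
    using vector_derivative_at[OF velocity[OF i t\<^sub>0]]
    by (simp add: a_def A_def f covariant_derivative_def eq_neg_iff_add_eq_0)
qed

end
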